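(* Let $q$ be a prime power, $n\ge1$ an integer, and $a,b,c\in\mathbb{F}_{q}$. Let $N$ be the number of primitive elements $x\in\mathbb{F}_{q^{n}}$ (generators of $\mathbb{F}_{q^{n}}^{*}$) with $\mathrm{Tr}(x)=a$, $\mathrm{Tr}(x^{2})=b$, $\mathrm{Tr}(x^{3})=c$. Then $$q^{3}N\ \ge\ \theta(q^{n}-1)\Big\{q^{n}-1+T_{1}-\sum_{i=2}^{8}|T_{i}|\Big\},$$ where $\theta(m)=\phi(m)/m$ and the $T_i$ are defined as follows. For $e_1,e_2,e_3\in\mathbb{F}_q$ and a multiplicative character $\chi$ of $\mathbb{F}_{q^n}$, put $$S_{\chi}(e_{1},e_{2},e_{3})=\sum_{\xi\in\mathbb{F}_{q^{n}}^{*}}\psi\big(\mathrm{Tr}(e_{1}\xi+e_{2}\xi^{2}+e_{3}\xi^{3})-e_{1}a-e_{2}b-e_{3}c\big)\chi(\xi),$$ and let $\chi_0$ be the trivial character. Then $T_{1}=\sum_{e_{1}\ne0}S_{\chi_0}(e_{1},0,0)$, $T_{2}=\sum_{e_{2}\ne0}S_{\chi_0}(0,e_{2},0)$, $T_{3}=\sum_{e_{3}\ne0}S_{\chi_0}(0,0,e_{3})$, $T_{4}=\sum_{e_{1},e_{2}\ne0}S_{\chi_0}(e_{1},e_{2},0)$, $T_{5}=\sum_{e_{1},e_{3}\ne0}S_{\chi_0}(e_{1},0,e_{3})$, $T_{6}=\sum_{e_{2},e_{3}\ne0}S_{\chi_0}(0,e_{2},e_{3})$, $T_{7}=\sum_{e_{1},e_{2},e_{3}\ne0}S_{\chi_0}(e_{1},e_{2},e_{3})$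 (all $e_i$ ranging over $\mathbb{F}_q$), and $$T_{8}=\sum_{1<d\mid q^{n}-1}\frac{\mu(d)}{\phi(d)}\sum_{\chi\ \text{of order}\ d}\ \sum_{e_{1},e_{2},e_{3}\in\mathbb{F}_{q}}S_{\chi}(e_{1},e_{2},e_{3}).$$
   Context: $\mathrm{Tr}$ is the trace map from $\mathbb{F}_{q^{n}}$ to $\mathbb{F}_{q}$; $\psi$ is the canonical additive character of $\mathbb{F}_{q}$; $\phi$ and $\mu$ are the Euler phi and Möbius functions; the inner sum in $T_8$ runs over all multiplicative characters of $\mathbb{F}_{q^{n}}^{*}$ of order exactly $d$. *)

theory Defs
  imports Complex_Main "HOL-Library.Cardinality" "HOL-Computational_Algebra.Squarefree" "HOL-Number_Theory.Number_Theory"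
begin

text \<open>
  The field with \<open>q ^ n\<close> elements is a finite field type \<open>'a\<close>; its subfield with \<open>q\<close> elements is
  a set \<open>K :: 'a set\<close>.
\<close>

definition is_subfield :: "'a::field set \<Rightarrow> bool" where
  "is_subfield K \<longleftrightarrow> 0 \<in> K \<and> 1 \<in> K \<and>
     (\<forall>x\<in>K. \<forall>y\<in>K. x + y \<in> K \<and> x * y \<in> K) \<and>
     (\<forall>x\<in>K. - x \<in> K \<and> inverse x \<in> K)"

text \<open>
  The trace of an extension of degree \<open>n\<close> of the field with \<open>q\<close> elements, as the sum of the
  Galois conjugates. Its values lie in the base field, here embedded in the type \<open>'a\<close>.
\<close>

definition field_trace :: "nat \<Rightarrow> nat \<Rightarrow> 'a::field \<Rightarrow> 'a" where
  "field_trace q n x = (\<Sum>i<n. x ^ (q ^ i))"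

text \<open>
  The canonical additive character \<open>y \<mapsto> exp (2 \<pi> i Tr(y) / p)\<close> of the field with
  \<open>p ^ m\<close> elements, where \<open>Tr\<close> is the absolute trace, whose value in the prime field is
  identified with its representative in \<open>{0..<p}\<close>. It is meaningful only for \<open>y\<close> in the
  subfield with \<open>p ^ m\<close> elements of a field of characteristic \<open>p\<close>.
\<close>

definition canonical_add_char :: "nat \<Rightarrow> nat \<Rightarrow> 'a::field \<Rightarrow> complex" where
  "canonical_add_char p m y =
     exp (2 * pi * \<i> * of_nat (THE k. k < p \<and> of_nat k = field_trace p m y) / of_nat p)"

text \<open>
  A homomorphism from the group of nonzero elements to that of nonzero complex numbers. The value
  \<open>0\<close> at \<open>0\<close> only makes the representation as a function on the whole type unique, so that
  sums over sets of characters count each character once.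
\<close>

definition mult_char :: "('a::field \<Rightarrow> complex) \<Rightarrow> bool" where
  "mult_char chi \<longleftrightarrow> chi 0 = 0 \<and> (\<forall>x. x \<noteq> 0 \<longrightarrow> chi x \<noteq> 0) \<and>
     (\<forall>x y. x \<noteq> 0 \<longrightarrow> y \<noteq> 0 \<longrightarrow> chi (x * y) = chi x * chi y)"

definition trivial_char :: "'a::field \<Rightarrow> complex" where
  "trivial_char x = (if x = 0 then 0 else 1)"

definition char_order :: "('a::field \<Rightarrow> complex) \<Rightarrow> nat" where
  "char_order chi = (LEAST k. k > 0 \<and> (\<forall>x. x \<noteq> 0 \<longrightarrow> chi x ^ k = 1))"

definition primitive_element :: "'a::field \<Rightarrow> bool" where
  "primitive_element x \<longleftrightarrow> range (\<lambda>k::int. x powi k) = UNIV - {0}"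

definition moebius_mu :: "nat \<Rightarrow> int" where
  "moebius_mu d = (if squarefree d then (-1) ^ card (prime_factors d) else 0)"

definition theta :: "nat \<Rightarrow> real" where
  "theta m = real (totient m) / real m"

text \<open>
  The sum attached to a multiplicative character and \<open>e1, e2, e3\<close>, with respect to the field
  with \<open>p ^ m\<close> elements and its extension \<open>'a\<close> of degree \<open>n\<close>.
\<close>

definition char_sum ::
  "nat \<Rightarrow> nat \<Rightarrow> nat \<Rightarrow> 'a::{field,finite} \<Rightarrow> 'a \<Rightarrow> 'a \<Rightarrow> ('a \<Rightarrow> complex) \<Rightarrow> 'a \<Rightarrow> 'a \<Rightarrow> 'a \<Rightarrow> complex" where
  "char_sum p m n a b c chi e1 e2 e3 =
     (\<Sum>\<xi>\<in>UNIV - {0}.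
        canonical_add_char p m
          (field_trace (p ^ m) n (e1 * \<xi> + e2 * \<xi> ^ 2 + e3 * \<xi> ^ 3) - e1 * a - e2 * b - e3 * c) * chi \<xi>)"

end

theory Submission
  imports Defs "HOL-Computational_Algebra.Polynomial"
begin

text \<open>
  The inequality is the real part of an identity. Vinogradov's formula writes the indicator function
  of primitivity as \<open>\<theta>(q\<^sup>n - 1) \<Sum>\<^sub>d \<mu>(d)/\<phi>(d) \<Sum>\<^sub>\<chi> \<chi>(x)\<close>, with \<open>d\<close> ranging over the divisors of
  \<open>q\<^sup>n - 1\<close> and \<open>\<chi>\<close> over the characters of order \<open>d\<close>, and orthogonality of the additive characters
  detects each trace condition at the cost of a factor \<open>q\<close>. Multiplying out gives
  \<open>q\<^sup>3 N = \<theta>(q\<^sup>n - 1) (q\<^sup>n - 1 + T\<^sub>1 + \<dots> + T\<^sub>8)\<close>. Here \<open>T\<^sub>1\<close> is real because \<open>e\<^sub>1 \<mapsto> - e\<^sub>1\<close> conjugates its terms.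
\<close>

section \<open>The multiplicative group of a finite field\<close>

text \<open>Multiplication by a nonzero \<open>x\<close> permutes the nonzero elements of
  \<open>K\<close>, so their product absorbs the factor \<open>x ^ (card K - 1)\<close>. Taking
  \<open>K = UNIV\<close> gives the same for the whole field.\<close>

lemma subfield_power_card:
  fixes K :: "'a::{field,finite} set"
  assumes K: "is_subfield K" and x: "x \<in> K"
  shows "x ^ card K = x"
proof (cases "x = 0")
  case True
  then show ?thesis using x by (auto simp: power_0_left card_eq_0_iff)
next
  case False
  let ?K = "K - {0}"
  have "bij_betw ((*) x) ?K ?K"
  proof (rule bij_betw_byWitness[where f' = "(*) (inverse x)"])
    show "(*) x ` ?K \<subseteq> ?K" "(*) (inverse x) ` ?K \<subseteq> ?K"
      using K x False unfolding is_subfield_def by auto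
  qed (use False in \<open>auto simp: field_simps\<close>)
  then have "\<Prod>?K = (\<Prod>y\<in>?K. x * y)"
    using prod.reindex_bij_betw[of "(*) x" ?K ?K "\<lambda>y. y"] by simp
  also have "\<dots> = x ^ card ?K * \<Prod>?K"
    by (simp add: prod.distrib)
  finally have "x ^ card ?K = 1" by simp
  moreover have "card K = Suc (card ?K)"
    using K by (subst card.remove[of _ 0]) (auto simp: is_subfield_def)
  ultimately show ?thesis by simp
qed

lemma nonzero_power_card:
  fixes x :: "'a::{field,finite}"
  assumes "x \<noteq> 0"
  shows "x ^ (CARD('a) - 1) = 1"
proof -
  have "x ^ CARD('a) = x"
    by (rule subfield_power_card) (auto simp: is_subfield_def)
  moreover have "CARD('a) = Suc (CARD('a) - 1)"
    by simp
  ultimately have "x * x ^ (CARD('a) - 1) = x"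
    by (metis power_Suc)
  then show ?thesis using assms by simp
qed

lemma card_field_minus_one_pos: "CARD('a::{field,finite}) - 1 > 0"
proof -
  have "card {0, 1 :: 'a} \<le> CARD('a)" by (intro card_mono) auto
  then show ?thesis by simp
qed

text \<open>Cyclicity of the unit group is known for fields given as records, so the type is
  repackaged as such a record and the generator is translated back. Natural exponents suffice since
  the group is finite.\<close>

lemma finite_field_generator:
  obtains g :: "'a::{field,finite}"
  where "range (\<lambda>t::nat. g ^ t) = UNIV - {0}"
proof -
  define R :: "'a ring" where
    "R = \<lparr>carrier = UNIV, monoid.mult = (*), one = 1, ring.zero = 0, add = (+)\<rparr>"
  have "\<exists>y. x * y = 1" if "x \<noteq> 0" for x :: 'a
    using that by (intro exI[of _ "inverse x"]) auto
  moreover have "\<exists>y. x + y = 0" for x :: 'a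
    using add.right_inverse by blast
  ultimately interpret R: field R
    unfolding R_def by unfold_locales (auto simp: algebra_simps Units_def)
  have carr: "carrier (mult_of R) = UNIV - {0}"
    by (auto simp: carrier_mult_of R_def)
  have pow: "x [^]\<^bsub>R\<^esub> (i::nat) = x ^ i" for x i
    by (induction i) (simp_all add: nat_pow_def R_def)
  have "finite (carrier R)" by (simp add: R_def)
  from R.finite_field_mult_group_has_gen[OF this]
  obtain g where g: "g \<in> carrier (mult_of R)"
      "carrier (mult_of R) = {g [^]\<^bsub>R\<^esub> i | i::nat. i \<in> UNIV}"
    by (rule bexE)
  have "range (\<lambda>t::nat. g ^ t) = UNIV - {0}"
    using g(2) unfolding carr pow by auto
  then show ?thesis by (rule that)
qed

lemma generatorD:
  fixes g :: "'a::field"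
  assumes g: "range (\<lambda>t::nat. g ^ t) = UNIV - {0}"
  shows "g \<noteq> 0" and "x \<noteq> 0 \<Longrightarrow> \<exists>t. x = g ^ t"
proof -
  have "g ^ 1 \<in> range (\<lambda>t::nat. g ^ t)" by blast
  then show "g \<noteq> 0" using g by simp
  assume "x \<noteq> 0"
  then have "x \<in> range (\<lambda>t::nat. g ^ t)" using g by simp
  then show "\<exists>t. x = g ^ t" by blast
qed

section \<open>Roots of unity and Vinogradov's formula\<close>

lemma power_eq_power_cong:
  fixes z :: "'a::monoid_mult"
  assumes "z ^ d = 1" "[i = j] (mod d)"
  shows "z ^ i = z ^ j"
proof -
  have "z ^ k = z ^ (k mod d)" for k
    by (metis assms(1) mod_mult_div_eq mult.right_neutral power_add power_mult power_one)
  then show ?thesis using assms(2) by (metis cong_def)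
qed

lemma cis_root_unity_power_eq_1_iff:
  assumes "d > 0"
  shows "cis (2 * pi / real d) ^ t = 1 \<longleftrightarrow> d dvd t"
proof -
  let ?w = "cis (2 * pi / real d)"
  have wd: "?w ^ d = 1" using assms by (simp add: DeMoivre)
  show ?thesis
  proof
    assume "?w ^ t = 1"
    then have "?w ^ (t mod d) = 1"
      using power_eq_power_cong[OF wd, of "t mod d" t] by simp
    then have "cis (2 * pi * real (t mod d) / real d) = cis (2 * pi * real 0 / real d)"
      by (simp add: DeMoivre mult_ac)
    \<comment> \<open>The points at the angles 2 pi k / d are distinct for k < d, and the remainder
      lies in that range.\<close>
    then have "t mod d = 0"
      by (rule inj_onD[OF bij_betw_imp_inj_on[OF bij_betw_roots_unity[OF assms]]])
         (use assms in auto)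
    then show "d dvd t" by auto
  next
    assume "d dvd t"
    then show "?w ^ t = 1" by (auto elim!: dvdE simp: power_mult wd)
  qed
qed

text \<open>If \<open>d\<close> does not divide \<open>t\<close>, rotation by a primitive root
  \<open>w\<close> permutes the roots but multiplies the sum by \<open>w ^ t\<close>, which is not
  1; hence the sum vanishes.\<close>

lemma sum_powers_roots_unity:
  assumes "d > 0"
  shows "(\<Sum>z | z ^ d = 1. z ^ t) = (if d dvd t then of_nat d else (0::complex))"
proof (cases "d dvd t")
  case True
  then obtain k where "t = d * k" by (elim dvdE)
  have "(\<Sum>z::complex | z ^ d = 1. z ^ t) = (\<Sum>z::complex | z ^ d = 1. 1)"
    by (intro sum.cong) (auto simp: power_mult \<open>t = d * k\<close>)
  then show ?thesis using True card_roots_unity_eq[OF assms] by simp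
next
  case False
  define w where "w = cis (2 * pi / real d)"
  have wd: "w ^ d = 1" and w0: "w \<noteq> 0" and wt: "w ^ t \<noteq> 1"
    using False cis_root_unity_power_eq_1_iff[OF assms] by (auto simp: w_def)
  have "bij_betw ((*) w) {z. z ^ d = 1} {z. z ^ d = 1}"
    by (rule bij_betw_byWitness[where f' = "(*) (inverse w)"])
       (use wd w0 in \<open>auto simp: power_mult_distrib power_inverse\<close>)
  then have "(\<Sum>z | z ^ d = 1. z ^ t) = (\<Sum>z | z ^ d = 1. (w * z) ^ t)"
    using sum.reindex_bij_betw[of "(*) w" _ _ "\<lambda>z. z ^ t"] by simp
  also have "\<dots> = w ^ t * (\<Sum>z | z ^ d = 1. z ^ t)"
    by (simp add: power_mult_distrib sum_distrib_left)
  finally show ?thesis using wt False by simp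
qed

section \<open>Squarefree divisors as sets of primes\<close>

lemma prime_factors_prod_primes:
  fixes P :: "nat set"
  assumes "finite P" "\<And>r. r \<in> P \<Longrightarrow> prime r"
  shows "prime_factors (\<Prod>P) = P"
proof -
  have "prime_factors (\<Prod>P) = (\<Union>r\<in>P. prime_factors r)"
    using assms by (subst prime_factors_prod) (auto dest: assms(2))
  also have "\<dots> = P" using assms(2) by (auto simp: prime_prime_factors)
  finally show ?thesis .
qed

lemma prod_prime_factors_squarefree:
  fixes d :: nat
  assumes "squarefree d"
  shows "\<Prod>(prime_factors d) = d"
proof -
  have "d \<noteq> 0" using assms not_squarefree_0 by metis
  have "d = (\<Prod>p\<in>prime_factors d. p ^ multiplicity p d)"
    using \<open>d \<noteq> 0\<close> by (simp add: prod_prime_factors)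
  also have "\<dots> = (\<Prod>p\<in>prime_factors d. p)"
  proof (intro prod.cong refl)
    fix p assume "p \<in> prime_factors d"
    then show "p ^ multiplicity p d = p"
      using assms \<open>d \<noteq> 0\<close> squarefree_factorial_semiring'[of d] by auto
  qed
  finally show ?thesis by simp
qed

text \<open>This turns a sum over squarefree divisors into a sum over sets of primes, which is the
  expansion of a product of binomials.\<close>

lemma bij_betw_prod_squarefree_divisors:
  fixes n :: nat
  assumes "n > 0"
  shows "bij_betw (\<lambda>P. \<Prod>P) (Pow (prime_factors n)) {d. d dvd n \<and> squarefree d}"
proof (rule bij_betw_byWitness[where f' = prime_factors])
  have P: "finite P" "\<And>r. r \<in> P \<Longrightarrow> prime r" if "P \<in> Pow (prime_factors n)" for P
    using that finite_subset[of P "prime_factors n"] by auto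
  show "\<forall>P\<in>Pow (prime_factors n). prime_factors (\<Prod>P) = P"
    using P prime_factors_prod_primes by metis
  show "\<forall>d\<in>{d. d dvd n \<and> squarefree d}. \<Prod>(prime_factors d) = d"
    using prod_prime_factors_squarefree by auto
  show "prime_factors ` {d. d dvd n \<and> squarefree d} \<subseteq> Pow (prime_factors n)"
    using assms by (auto simp: prime_factors_dvd intro: dvd_trans)
  show "(\<lambda>P. \<Prod>P) ` Pow (prime_factors n) \<subseteq> {d. d dvd n \<and> squarefree d}"
  proof safe
    fix P assume PP: "P \<subseteq> prime_factors n"
    then have P': "finite P" "\<And>r. r \<in> P \<Longrightarrow> prime r" using P by auto
    show "squarefree (\<Prod>P)"
      by (rule squarefree_prod_coprime) (use P' in \<open>auto intro: primes_coprime squarefree_prime\<close>)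
    have "\<Prod>P dvd \<Prod>(prime_factors n)" using PP by (intro prod_dvd_prod_subset) auto
    also have "\<dots> dvd (\<Prod>p\<in>prime_factors n. p ^ multiplicity p n)"
      by (intro prod_dvd_prod) (auto simp: prime_factors_multiplicity intro: dvd_power)
    also have "\<dots> = n" using assms by (simp add: prod_prime_factors)
    finally show "\<Prod>P dvd n" .
  qed
qed

lemma prod_primes_dvd:
  fixes t :: nat
  assumes "finite P" "\<And>r. r \<in> P \<Longrightarrow> prime r \<and> r dvd t"
  shows "\<Prod>P dvd t"
  using assms
proof (induction P rule: finite_induct)
  case (insert r P)
  have "coprime r (\<Prod>P)"
    by (rule prod_coprime_right) (use insert in \<open>auto intro!: primes_coprime\<close>)
  then show ?case using insert by (simp add: divides_mult)
qed simp

text \<open>This is the Ramanujan sum in product form. The product on the right has the same divisor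
  sums as \<open>F\<close>, because its expansion over sets of primes collapses to a product of
  factors r or 0; by strong induction, equal divisor sums force equal values.\<close>

lemma divisor_sum_squarefree_unique:
  fixes F :: "nat \<Rightarrow> complex"
  assumes "squarefree d"
    and "\<And>e. e dvd d \<Longrightarrow> (\<Sum>k | k dvd e. F k) = (if e dvd t then of_nat e else 0)"
  shows "F d = (\<Prod>r\<in>prime_factors d. (if r dvd t then of_nat r else 0) - 1)"
  using assms
proof (induction d rule: less_induct)
  case (less d)
  define R where "R k = (\<Prod>r\<in>prime_factors k. (if r dvd t then of_nat r else 0) - (1::complex))" for k
  have d: "d > 0" using less.prems(1) not_squarefree_0 by (metis gr0I)
  have fin: "finite {k. k dvd d}" using d by simp
  have eq: "{k. k dvd d} = insert d {k. k dvd d \<and> k \<noteq> d}" by auto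
  have "(\<Sum>k | k dvd d. R k) = (\<Sum>k | k dvd d \<and> squarefree k. R k)"
    using less.prems(1) by (intro sum.cong) (auto intro: squarefree_mono)
  also have "\<dots> = (\<Sum>P\<in>Pow (prime_factors d). R (\<Prod>P))"
    by (rule sum.reindex_bij_betw[symmetric, OF bij_betw_prod_squarefree_divisors[OF d]])
  also have "\<dots> = (\<Sum>P\<in>Pow (prime_factors d). \<Prod>r\<in>P. (if r dvd t then of_nat r else 0) - (1::complex))"
  proof (intro sum.cong refl)
    fix P assume "P \<in> Pow (prime_factors d)"
    then have "prime_factors (\<Prod>P) = P"
      using finite_subset[of P "prime_factors d"] by (intro prime_factors_prod_primes) auto
    then show "R (\<Prod>P) = (\<Prod>r\<in>P. (if r dvd t then of_nat r else 0) - (1::complex))"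
      by (simp add: R_def)
  qed
  \<comment> \<open>The sum over all subsets P of a product over P is the expansion of the product
    of the factors plus 1.\<close>
  also have "\<dots> = (\<Prod>r\<in>prime_factors d. ((if r dvd t then of_nat r else 0) - 1) + (1::complex))"
    by (subst prod_add) auto
  also have "\<dots> = (\<Prod>r\<in>prime_factors d. if r dvd t then of_nat r else 0)"
    by (intro prod.cong) auto
  also have "\<dots> = (if d dvd t then of_nat d else 0)"
  proof (cases "d dvd t")
    case True
    then have "(\<Prod>r\<in>prime_factors d. if r dvd t then of_nat r else (0::complex)) =
                 of_nat (\<Prod>(prime_factors d))"
      unfolding of_nat_prod by (intro prod.cong) (auto intro: dvd_trans)
    then show ?thesis using True prod_prime_factors_squarefree[OF less.prems(1)] by simp
  next
    case False
    have "\<exists>r\<in>prime_factors d. \<not> r dvd t"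
      using False prod_primes_dvd[of "prime_factors d" t]
        prod_prime_factors_squarefree[OF less.prems(1)] by auto
    then show ?thesis using False by auto
  qed
  finally have "(\<Sum>k | k dvd d. R k) = (\<Sum>k | k dvd d. F k)"
    using less.prems(2)[of d] by simp
  \<comment> \<open>All proper divisors are covered by the induction hypothesis, so the two divisor
    sums can differ only in the term of \<open>d\<close> itself.\<close>
  moreover have "F k = R k" if "k dvd d" "k \<noteq> d" for k
    unfolding R_def
  proof (rule less.IH)
    show "k < d" using that d by (metis dvd_imp_le le_neq_implies_less)
    show "squarefree k" using less.prems(1) that squarefree_mono by blast
    show "(\<Sum>k | k dvd e. F k) = (if e dvd t then of_nat e else 0)" if "e dvd k" for e
      using less.prems(2) that \<open>k dvd d\<close> dvd_trans by blast
  qed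
  then have "(\<Sum>k | k dvd d \<and> k \<noteq> d. F k) = (\<Sum>k | k dvd d \<and> k \<noteq> d. R k)"
    by (intro sum.cong) auto
  ultimately show ?case
    using fin by (simp add: eq R_def)
qed

lemma totient_prod_primes:
  assumes "finite P" "\<And>r. r \<in> P \<Longrightarrow> prime r"
  shows "totient (\<Prod>P) = (\<Prod>r\<in>P. r - 1)"
proof -
  have "totient (\<Prod>P) = (\<Prod>r\<in>P. totient r)"
    by (rule totient_prod_coprime) (use assms in \<open>auto simp: pairwise_def intro: primes_coprime\<close>)
  also have "\<dots> = (\<Prod>r\<in>P. r - 1)"
    using assms by (intro prod.cong) (auto simp: totient_prime)
  finally show ?thesis .
qed

text \<open>Vinogradov's formula for the indicator function of \<open>coprime t M\<close>, with \<open>F d\<close> in the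
  role of the Ramanujan sum \<open>c\<^sub>d(t)\<close>.\<close>

lemma moebius_totient_sum:
  fixes F :: "nat \<Rightarrow> complex"
  assumes M: "M > 0"
    and F: "\<And>e. e dvd M \<Longrightarrow> (\<Sum>k | k dvd e. F k) = (if e dvd t then of_nat e else 0)"
  shows "of_real (theta M) * (\<Sum>d | d dvd M. of_int (moebius_mu d) / of_nat (totient d) * F d)
    = (if coprime t M then 1 else 0)"
proof -
  let ?R = "\<lambda>r. (if r dvd t then of_nat r else 0) - (1::complex)"
  have "(\<Sum>d | d dvd M. of_int (moebius_mu d) / of_nat (totient d) * F d) =
      (\<Sum>d | d dvd M \<and> squarefree d. of_int (moebius_mu d) / of_nat (totient d) * F d)"
    using M by (intro sum.mono_neutral_right) (auto simp: moebius_mu_def)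
  also have "\<dots> = (\<Sum>P\<in>Pow (prime_factors M).
      of_int (moebius_mu (\<Prod>P)) / of_nat (totient (\<Prod>P)) * F (\<Prod>P))"
    by (rule sum.reindex_bij_betw[symmetric, OF bij_betw_prod_squarefree_divisors[OF M]])
  \<comment> \<open>Each prime of P takes one sign from the Moebius function and one factor r - 1
    from the totient, so the whole summand is multiplicative.\<close>
  also have "\<dots> = (\<Sum>P\<in>Pow (prime_factors M). \<Prod>r\<in>P. - ?R r / of_nat (r - 1))"
  proof (intro sum.cong refl)
    fix P assume P: "P \<in> Pow (prime_factors M)"
    then have P': "finite P" "\<And>r. r \<in> P \<Longrightarrow> prime r"
      using finite_subset[of P "prime_factors M"] by auto
    have "\<Prod>P dvd M" "squarefree (\<Prod>P)"
      using bij_betwE[OF bij_betw_prod_squarefree_divisors[OF M]] P by auto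
    then have "F (\<Prod>P) = (\<Prod>r\<in>prime_factors (\<Prod>P). ?R r)"
      using F dvd_trans by (intro divisor_sum_squarefree_unique) blast+
    then show "of_int (moebius_mu (\<Prod>P)) / of_nat (totient (\<Prod>P)) * F (\<Prod>P) =
        (\<Prod>r\<in>P. - ?R r / of_nat (r - 1))"
      using \<open>squarefree (\<Prod>P)\<close> P'
      by (simp add: moebius_mu_def prime_factors_prod_primes totient_prod_primes
            prod_dividef prod_uminus del: minus_diff_eq)
  qed
  also have "\<dots> = (\<Prod>r\<in>prime_factors M. - ?R r / of_nat (r - 1) + 1)"
    by (subst prod_add) auto
  \<comment> \<open>If r divides \<open>t\<close>, the local factor is -(r - 1)/(r - 1) + 1 = 0.
    Otherwise it is 1/(r - 1) + 1 = 1/(1 - 1/r), and these multiply to the inverse of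
    theta(M).\<close>
  also have "\<dots> = (\<Prod>r\<in>prime_factors M. if r dvd t then 0 else of_real (1 / (1 - 1 / real r)))"
  proof (intro prod.cong refl)
    fix r assume "r \<in> prime_factors M"
    then have "r > 1" using prime_gt_1_nat by blast
    then have "of_nat (r - 1) = (of_nat r - 1 :: complex)" "of_nat r - 1 \<noteq> (0::complex)"
      "of_nat r \<noteq> (0::complex)"
      by (auto simp: of_nat_diff)
    then show "- ?R r / of_nat (r - 1) + 1 = (if r dvd t then 0 else of_real (1 / (1 - 1 / real r)))"
      by (auto simp: field_simps)
  qed
  finally have eq: "(\<Sum>d | d dvd M. of_int (moebius_mu d) / of_nat (totient d) * F d) = \<dots>" .
  show ?thesis
  proof (cases "coprime t M")
    case True
    have "(\<Prod>r\<in>prime_factors M. if r dvd t then 0 else complex_of_real (1 / (1 - 1 / real r))) =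
        of_real (\<Prod>r\<in>prime_factors M. 1 / (1 - 1 / real r))"
      unfolding of_real_prod
    proof (intro prod.cong refl)
      fix r assume "r \<in> prime_factors M"
      then have "\<not> r dvd t" using True by (metis coprime_common_divisor in_prime_factors_iff not_prime_unit)
      then show "(if r dvd t then 0 else complex_of_real (1 / (1 - 1 / real r))) =
        of_real (1 / (1 - 1 / real r))" by simp
    qed
    moreover have "theta M = (\<Prod>r\<in>prime_factors M. 1 - 1 / real r)"
      using M by (simp add: theta_def totient_formula2)
    moreover have "theta M \<noteq> 0" using M by (simp add: theta_def)
    ultimately have "complex_of_real (theta M) * (\<Prod>r\<in>prime_factors M.
        if r dvd t then 0 else of_real (1 / (1 - 1 / real r))) = of_real (theta M * (1 / theta M))"
      by (simp only: of_real_mult prod_dividef prod.neutral_const)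
    then show ?thesis using True \<open>theta M \<noteq> 0\<close> by (simp only: eq) simp
  next
    case False
    then have "gcd t M \<noteq> 1" by (simp only: coprime_iff_gcd_eq_1 not_False_eq_True)
    then obtain r where "prime r" "r dvd gcd t M"
      using prime_factor_nat by blast
    then have "r \<in> prime_factors M" "r dvd t" using M by (auto simp: prime_factors_dvd)
    then have "(\<Prod>r\<in>prime_factors M.
        if r dvd t then 0 else complex_of_real (1 / (1 - 1 / real r))) = 0"
      by (intro prod_zero) auto
    then show ?thesis using False by (simp only: eq) simp
  qed
qed

section \<open>Primitive elements and multiplicative characters\<close>

lemma generator_power_eq_1_iff:
  fixes g :: "'a::{field,finite}"
  assumes g: "range (\<lambda>t::nat. g ^ t) = UNIV - {0}"
  shows "g ^ i = 1 \<longleftrightarrow> CARD('a) - 1 dvd i"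
proof
  let ?M = "CARD('a) - 1"
  have gM: "g ^ ?M = 1" by (rule nonzero_power_card) (rule generatorD(1)[OF g])
  show "g ^ i = 1" if "?M dvd i"
    using that gM by (metis dvdE power_mult power_one)
  assume "g ^ i = 1"
  define k where "k = i mod ?M"
  have "g ^ k = g ^ i"
    by (rule power_eq_power_cong[OF gM]) (simp add: k_def cong_def)
  then have gk: "g ^ k = 1" using \<open>g ^ i = 1\<close> by simp
  have "k < ?M" using card_field_minus_one_pos[where 'a = 'a] by (simp add: k_def)
  have "k = 0"
  proof (rule ccontr)
    assume "k \<noteq> 0"
    \<comment> \<open>A smaller positive period \<open>k\<close> would leave at most
      \<open>k\<close> distinct powers, too few to be all nonzero elements.\<close>
    have "UNIV - {0} \<subseteq> (\<lambda>j. g ^ j) ` {..<k}"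
    proof
      fix x :: 'a assume "x \<in> UNIV - {0}"
      then obtain t where "x = g ^ t" using generatorD(2)[OF g] by auto
      then have "x = g ^ (t mod k)"
        using power_eq_power_cong[OF gk, of t "t mod k"] by simp
      then show "x \<in> (\<lambda>j. g ^ j) ` {..<k}" using \<open>k \<noteq> 0\<close> by auto
    qed
    then have "card (UNIV - {0::'a}) \<le> card {..<k}"
      by (rule surj_card_le[OF finite_lessThan])
    then show False using \<open>k < ?M\<close> by (simp add: card_Diff_singleton)
  qed
  then show "?M dvd i" by (simp add: k_def mod_eq_0_iff_dvd)
qed

lemma generator_power_eq_iff:
  fixes g :: "'a::{field,finite}"
  assumes g: "range (\<lambda>t::nat. g ^ t) = UNIV - {0}"
  shows "g ^ i = g ^ j \<longleftrightarrow> [i = j] (mod (CARD('a) - 1))"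
proof (induction i j rule: linorder_wlog)
  case (le i j)
  have "g ^ j = g ^ i * g ^ (j - i)" using le by (simp flip: power_add)
  then have "g ^ i = g ^ j \<longleftrightarrow> g ^ (j - i) = 1" using generatorD(1)[OF g] by auto
  also have "\<dots> \<longleftrightarrow> [i = j] (mod (CARD('a) - 1))"
    using le by (simp add: generator_power_eq_1_iff[OF g] cong_sym_eq[of i] cong_altdef_nat)
  finally show ?case .
next
  case (sym i j)
  then show ?case by (metis cong_sym_eq)
qed

text \<open>Primitivity is phrased with integer exponents, the discrete logarithm with natural ones.
  The bridge is that the inverse of \<open>x\<close> is the power with exponent
  \<open>CARD('a) - 2\<close>.\<close>

lemma power_int_eq_power:
  fixes x :: "'a::{field,finite}"
  assumes "x \<noteq> 0"
  shows "\<exists>s::nat. x powi k = x ^ s"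
proof (cases "k \<ge> 0")
  case True
  then show ?thesis by (auto simp: power_int_def)
next
  case False
  have "x * x ^ (CARD('a) - 2) = x ^ (CARD('a) - 1)"
    using card_field_minus_one_pos[where 'a = 'a] by (simp flip: power_Suc add: Suc_diff_Suc numeral_2_eq_2)
  also have "\<dots> = 1" using assms by (rule nonzero_power_card)
  finally have "inverse x = x ^ (CARD('a) - 2)" by (rule inverse_unique)
  then have "x powi k = x ^ ((CARD('a) - 2) * nat (- k))"
    using False by (simp add: power_int_def power_mult)
  then show ?thesis by blast
qed

lemma primitive_element_nonzero:
  assumes "primitive_element x"
  shows "x \<noteq> 0"
proof -
  have "x powi 1 \<in> range (\<lambda>k::int. x powi k)" by blast
  then show ?thesis using assms by (simp add: primitive_element_def)
qed

text \<open>\<open>g ^ t\<close> is primitive exactly when \<open>g\<close> is one of its powers,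
  that is, when t s = 1 is solvable modulo the group order.\<close>

lemma primitive_element_generator_power_iff:
  fixes g :: "'a::{field,finite}"
  assumes g: "range (\<lambda>t::nat. g ^ t) = UNIV - {0}"
  shows "primitive_element (g ^ t) \<longleftrightarrow> coprime t (CARD('a) - 1)"
proof
  assume "primitive_element (g ^ t)"
  then have "g \<in> range (\<lambda>k::int. (g ^ t) powi k)"
    using generatorD(1)[OF g] by (simp add: primitive_element_def)
  then obtain k where "g = (g ^ t) powi k" by auto
  then obtain s where "g = (g ^ t) ^ s"
    using power_int_eq_power[of "g ^ t" k] generatorD(1)[OF g] by auto
  then have "g ^ (t * s) = g ^ 1" by (simp add: power_mult)
  then have "[t * s = 1] (mod (CARD('a) - 1))"
    using generator_power_eq_iff[OF g] by blast
  then show "coprime t (CARD('a) - 1)" by (auto simp: coprime_iff_invertible_nat)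
next
  assume "coprime t (CARD('a) - 1)"
  then obtain s where "[t * s = 1] (mod (CARD('a) - 1))"
    by (auto simp: coprime_iff_invertible_nat)
  then have s: "g ^ (t * s) = g"
    using generator_power_eq_iff[OF g, of "t * s" 1] by simp
  have "x \<in> range (\<lambda>k::int. (g ^ t) powi k)" if x: "x \<noteq> 0" for x
  proof -
    obtain j where j: "x = g ^ j" using generatorD(2)[OF g x] by (elim exE)
    have "(g ^ t) ^ (s * j) = (g ^ (t * s)) ^ j"
      by (simp only: mult.assoc flip: power_mult)
    then have "x = (g ^ t) powi int (s * j)"
      unfolding power_int_of_nat s j by simp
    then show ?thesis by blast
  qed
  then show "primitive_element (g ^ t)"
    using generatorD(1)[OF g] by (auto simp: primitive_element_def)
qed

section \<open>Multiplicative characters and their orders\<close>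

lemma mult_char_one: "mult_char chi \<Longrightarrow> chi 1 = 1"
  unfolding mult_char_def by (metis mult.right_neutral mult_cancel_left one_neq_zero)

lemma mult_char_power:
  assumes "mult_char chi" "x \<noteq> 0"
  shows "chi (x ^ t) = chi x ^ t"
  using assms by (induction t) (auto simp: mult_char_one, simp add: mult_char_def)

text \<open>The remainder of \<open>k\<close> modulo the order is again an annihilating exponent, so
  by minimality it cannot be positive.\<close>

lemma char_order_dvd_iff:
  fixes chi :: "'a::{field,finite} \<Rightarrow> complex"
  assumes chi: "mult_char chi" and "k > 0"
  shows "char_order chi dvd k \<longleftrightarrow> (\<forall>x. x \<noteq> 0 \<longrightarrow> chi x ^ k = 1)"
proof -
  let ?P = "\<lambda>k. k > 0 \<and> (\<forall>x. x \<noteq> 0 \<longrightarrow> chi x ^ k = 1)"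
  \<comment> \<open>The group order annihilates every character, so the minimum that defines
    \<open>char_order\<close> is attained.\<close>
  have "chi x ^ (CARD('a) - 1) = 1" if "x \<noteq> 0" for x
    using mult_char_power[OF chi that] nonzero_power_card[OF that] mult_char_one[OF chi] by metis
  then have "?P (CARD('a) - 1)"
    using card_field_minus_one_pos[where 'a = 'a] by blast
  then have o: "?P (char_order chi)"
    unfolding char_order_def by (rule LeastI)
  show ?thesis
  proof
    assume "char_order chi dvd k"
    then show "\<forall>x. x \<noteq> 0 \<longrightarrow> chi x ^ k = 1"
      using o by (auto elim!: dvdE simp: power_mult)
  next
    assume k: "\<forall>x. x \<noteq> 0 \<longrightarrow> chi x ^ k = 1"
    let ?r = "k mod char_order chi"
    have "chi x ^ ?r = 1" if "x \<noteq> 0" for x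
      using power_eq_power_cong[of "chi x" "char_order chi" ?r k] o k that by simp
    then have "\<not> ?r > 0"
      using Least_le[of ?P ?r] o mod_less_divisor[of "char_order chi" k]
      by (fold char_order_def) (meson not_le)
    then show "char_order chi dvd k" by auto
  qed
qed

text \<open>A character is determined by its value at a generator. Conversely a \<open>d\<close>-th
  root of unity can be prescribed there, because \<open>d\<close> divides the group order.\<close>

lemma bij_betw_mult_chars_roots_unity:
  fixes g :: "'a::{field,finite}"
  assumes g: "range (\<lambda>t::nat. g ^ t) = UNIV - {0}"
    and d: "d dvd CARD('a) - 1"
  shows "bij_betw (\<lambda>chi. chi g) {chi. mult_char chi \<and> char_order chi dvd d} {z. z ^ d = 1}"
proof -
  have "d > 0" using d card_field_minus_one_pos[where 'a = 'a] by (metis dvd_0_left gr0I less_irrefl)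
  \<comment> \<open>A discrete logarithm to the base \<open>g\<close>; the least exponent is merely
    a choice of representative.\<close>
  define L where "L x = (LEAST t. x = g ^ t)" for x
  have L: "g ^ L x = x" if "x \<noteq> 0" for x
    unfolding L_def using LeastI_ex[OF generatorD(2)[OF g that]] by simp
  define f' where "f' z x = (if x = 0 then 0 else z ^ L x)" for z :: complex and x
  \<comment> \<open>The power of \<open>z\<close> does not depend on the logarithm chosen: exponents
    agreeing modulo the group order agree modulo \<open>d\<close>. Multiplicativity of
    \<open>f' z\<close> rests on this.\<close>
  have pow: "z ^ i = z ^ j" if "z ^ d = 1" "g ^ i = g ^ j" for z :: complex and i j
  proof (rule power_eq_power_cong[OF that(1)])
    have "[i = j] (mod (CARD('a) - 1))"
      using that(2) iffD1[OF generator_power_eq_iff[OF g]] by blast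
    then show "[i = j] (mod d)" using d by (rule cong_dvd_modulus_nat)
  qed
  have chi_L: "chi x = chi g ^ L x" if "mult_char chi" "x \<noteq> 0" for chi :: "'a \<Rightarrow> complex" and x
    using mult_char_power[OF that(1) generatorD(1)[OF g], of "L x"] L[OF that(2)] by simp
  have mc: "mult_char (f' z)" if z: "z ^ d = 1" for z
    unfolding mult_char_def
  proof (intro conjI allI impI)
    have "z \<noteq> 0" using z \<open>d > 0\<close> by (auto simp: power_0_left)
    then show "f' z x \<noteq> 0" if "x \<noteq> 0" for x using that by (simp add: f'_def)
    fix x y :: 'a assume xy: "x \<noteq> 0" "y \<noteq> 0"
    have "z ^ L (x * y) = z ^ (L x + L y)"
      by (rule pow[OF z]) (use xy L in \<open>simp add: power_add\<close>)
    then show "f' z (x * y) = f' z x * f' z y"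
      using xy by (simp add: f'_def power_add)
  qed (simp add: f'_def)
  show ?thesis
  proof (rule bij_betw_byWitness[where f' = f'])
    show "\<forall>chi\<in>{chi. mult_char chi \<and> char_order chi dvd d}. f' (chi g) = chi"
      using chi_L by (auto simp: f'_def fun_eq_iff mult_char_def)
    show "\<forall>z\<in>{z. z ^ d = 1}. f' z g = z"
    proof safe
      fix z :: complex assume "z ^ d = 1"
      then have "z ^ L g = z ^ 1" using L[OF generatorD(1)[OF g]] by (intro pow) auto
      then show "f' z g = z" using generatorD(1)[OF g] by (simp add: f'_def)
    qed
    show "(\<lambda>chi. chi g) ` {chi. mult_char chi \<and> char_order chi dvd d} \<subseteq> {z. z ^ d = 1}"
      using generatorD(1)[OF g] \<open>d > 0\<close> by (auto simp: char_order_dvd_iff)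
    show "f' ` {z. z ^ d = 1} \<subseteq> {chi. mult_char chi \<and> char_order chi dvd d}"
    proof safe
      fix z :: complex assume z: "z ^ d = 1"
      show "mult_char (f' z)" by (rule mc[OF z])
      then show "char_order (f' z) dvd d"
        using \<open>d > 0\<close> z by (auto simp: char_order_dvd_iff f'_def power_commutes simp flip: power_mult)
          (metis mult.commute power_mult power_one)
    qed
  qed
qed

text \<open>The sum of the values at \<open>g ^ t\<close> of the characters of order k thus meets
  the divisor sum condition on \<open>F\<close> in \<open>moebius_totient_sum\<close>. After
  grouping by exact order it is a sum of powers of roots of unity.\<close>

lemma sum_mult_chars_order_dvd:
  fixes g :: "'a::{field,finite}"
  assumes g: "range (\<lambda>t::nat. g ^ t) = UNIV - {0}"
    and d: "d dvd CARD('a) - 1"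
  shows "(\<Sum>k | k dvd d. \<Sum>chi | mult_char chi \<and> char_order chi = k. chi (g ^ t)) =
    (if d dvd t then of_nat d else 0)"
proof -
  let ?C = "{chi :: 'a \<Rightarrow> complex. mult_char chi \<and> char_order chi dvd d}"
  note bij = bij_betw_mult_chars_roots_unity[OF g d]
  have "d > 0" using d card_field_minus_one_pos[where 'a = 'a] by (metis dvd_0_left gr0I less_irrefl)
  have "finite {z::complex. z ^ d = 1}" using \<open>d > 0\<close> by (intro finite_roots_unity) simp
  then have "finite ?C" using bij_betw_finite[OF bij] by simp
  have "(\<Sum>k | k dvd d. \<Sum>chi | mult_char chi \<and> char_order chi = k. chi (g ^ t)) =
      (\<Sum>k\<in>{k. k dvd d}. \<Sum>chi\<in>{chi \<in> ?C. char_order chi = k}. chi (g ^ t))"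
    by (intro sum.cong refl) auto
  also have "\<dots> = (\<Sum>chi\<in>?C. chi (g ^ t))"
    using \<open>finite ?C\<close> \<open>d > 0\<close> by (intro sum.group) auto
  also have "\<dots> = (\<Sum>chi\<in>?C. chi g ^ t)"
    using generatorD(1)[OF g] by (intro sum.cong) (auto simp: mult_char_power)
  also have "\<dots> = (\<Sum>z | z ^ d = 1. z ^ t)"
    by (rule sum.reindex_bij_betw[OF bij])
  finally show ?thesis using sum_powers_roots_unity[OF \<open>d > 0\<close>] by simp
qed

lemma primitive_element_indicator:
  fixes x :: "'a::{field,finite}"
  assumes "x \<noteq> 0"
  shows "of_real (theta (CARD('a) - 1)) *
      (\<Sum>d | d dvd CARD('a) - 1. of_int (moebius_mu d) / of_nat (totient d) *
        (\<Sum>chi | mult_char chi \<and> char_order chi = d. chi x)) =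
    (if primitive_element x then 1 else 0)"
proof -
  obtain g :: 'a where g: "range (\<lambda>t::nat. g ^ t) = UNIV - {0}"
    by (rule finite_field_generator)
  obtain t where t: "x = g ^ t" using generatorD(2)[OF g assms] by (elim exE)
  show ?thesis
    unfolding t primitive_element_generator_power_iff[OF g]
    by (rule moebius_totient_sum[OF card_field_minus_one_pos])
       (rule sum_mult_chars_order_dvd[OF g])
qed

text \<open>It isolates the term d = 1 of Vinogradov's formula, the source of the main term and of
  T1 to T7.\<close>

lemma mult_chars_of_order_one:
  "{chi :: 'a::{field,finite} \<Rightarrow> complex. mult_char chi \<and> char_order chi = 1} = {trivial_char}"
proof -
  have "char_order chi = 1 \<longleftrightarrow> (\<forall>x. x \<noteq> 0 \<longrightarrow> chi x = 1)" if "mult_char chi"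
    for chi :: "'a \<Rightarrow> complex"
    using char_order_dvd_iff[OF that, of 1] by simp
  moreover have "mult_char (trivial_char :: 'a \<Rightarrow> complex)"
    by (simp add: mult_char_def trivial_char_def)
  ultimately show ?thesis
    by (auto simp: trivial_char_def mult_char_def fun_eq_iff)
qed

section \<open>Traces and the additive character\<close>

lemma CHAR_eq_of_card_prime_power:
  assumes "prime p" "CARD('a::{field,finite}) = p ^ k"
  shows "CHAR('a) = p"
proof -
  have "prime CHAR('a)"
    by (intro prime_CHAR_semidom finite_imp_CHAR_pos) auto
  moreover have "CHAR('a) dvd p ^ k"
    using CHAR_dvd_CARD[where 'a = 'a] assms(2) by simp
  ultimately have "CHAR('a) dvd p"
    by (rule prime_dvd_power)
  then show ?thesis
    using \<open>prime CHAR('a)\<close> assms(1) by (simp add: primes_dvd_imp_eq)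
qed

lemma card_power_fixed_points_le:
  assumes "k > 1"
  shows "card {x :: 'a::field. x ^ k = x} \<le> k"
proof -
  let ?P = "monom 1 k - monom 1 1 :: 'a poly"
  have "coeff ?P k = 1" using assms by simp
  then have "?P \<noteq> 0" by (metis coeff_0 zero_neq_one)
  then have "card {x. poly ?P x = 0} \<le> degree ?P" by (rule card_poly_roots_bound)
  also have "degree ?P \<le> k"
    using assms by (intro degree_diff_le) (auto intro: order.trans[OF degree_monom_le])
  finally show ?thesis by (simp add: poly_monom)
qed

text \<open>\<open>K\<close> consists of roots of X^k - X with k = \<open>card K\<close>, and this
  polynomial has no more than k roots. Membership in \<open>K\<close> thereby becomes an
  equation.\<close>

lemma subfield_eq_fixed_points:
  fixes K :: "'a::{field,finite} set"
  assumes K: "is_subfield K"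
  shows "K = {x. x ^ card K = x}"
proof (rule card_subset_eq)
  show sub: "K \<subseteq> {x. x ^ card K = x}" using subfield_power_card[OF K] by auto
  have "card {0, 1 :: 'a} \<le> card K"
    using K by (intro card_mono) (auto simp: is_subfield_def)
  then have "card {x :: 'a. x ^ card K = x} \<le> card K"
    by (intro card_power_fixed_points_le) simp
  moreover have "card K \<le> card {x :: 'a. x ^ card K = x}"
    by (rule card_mono[OF finite sub])
  ultimately show "card K = card {x :: 'a. x ^ card K = x}" by simp
qed simp

text \<open>The multiples of 1 below the characteristic p are p distinct roots of X^p - X, hence all
  of them.\<close>

lemma prime_field_eq_fixed_points:
  assumes "prime CHAR('a::{field,finite})"
  shows "of_nat ` {..<CHAR('a)} = {x :: 'a. x ^ CHAR('a) = x}"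
proof (rule card_seteq)
  have "of_nat k ^ CHAR('a) = (of_nat k :: 'a)" for k
    using assms by (induction k) (auto simp: freshmans_dream prime_gt_0_nat)
  then show "of_nat ` {..<CHAR('a)} \<subseteq> {x :: 'a. x ^ CHAR('a) = x}" by auto
  have "inj_on (of_nat :: nat \<Rightarrow> 'a) {..<CHAR('a)}"
    by (auto simp: inj_on_def of_nat_eq_iff_cong_CHAR cong_def)
  then have "card ((of_nat :: nat \<Rightarrow> 'a) ` {..<CHAR('a)}) = CHAR('a)"
    by (simp add: card_image)
  then show "card {x :: 'a. x ^ CHAR('a) = x} \<le> card ((of_nat :: nat \<Rightarrow> 'a) ` {..<CHAR('a)})"
    using card_power_fixed_points_le[OF prime_gt_1_nat[OF assms], where 'a = 'a] by simp
qed simp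

lemma field_trace_add:
  fixes x y :: "'a::field"
  assumes "prime CHAR('a)" "q = CHAR('a) ^ j"
  shows "field_trace q n (x + y) = field_trace q n x + field_trace q n y"
proof -
  have "(x + y) ^ (q ^ i) = x ^ (q ^ i) + y ^ (q ^ i)" for i
    by (rule freshmans_dream'[OF assms(1), of _ "j * i"]) (simp add: assms(2) power_mult)
  then show ?thesis by (simp add: field_trace_def sum.distrib)
qed

lemma field_trace_scale:
  fixes e x :: "'a::field"
  assumes e: "e ^ q = e"
  shows "field_trace q n (e * x) = e * field_trace q n x"
proof -
  have "e ^ (q ^ i) = e" for i
    by (induction i) (simp_all add: power_mult e)
  then show ?thesis
    by (simp add: field_trace_def power_mult_distrib sum_distrib_left)
qed

text \<open>The \<open>q\<close>-th power shifts the conjugates cyclically. This serves both the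
  trace from the large field to \<open>K\<close> and the absolute trace from \<open>K\<close> to the
  prime field.\<close>

lemma field_trace_power_base:
  fixes x :: "'a::field"
  assumes "prime CHAR('a)" "q = CHAR('a) ^ j" and x: "x ^ (q ^ n) = x"
  shows "field_trace q n x ^ q = field_trace q n x"
proof -
  have "field_trace q n x ^ q = (\<Sum>i<n. x ^ (q ^ Suc i))"
    unfolding field_trace_def
    by (subst freshmans_dream_sum'[OF assms(1,2)]) (simp flip: power_mult add: mult.commute)
  \<comment> \<open>With \<open>x\<close> added in front, the shifted sum is the sum over
    \<open>Suc n\<close> terms, whose last term is \<open>x\<close> again.\<close>
  also have "x + \<dots> = (\<Sum>i<Suc n. x ^ (q ^ i))"
    unfolding sum.lessThan_Suc_shift by simp
  also have "\<dots> = field_trace q n x + x"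
    by (simp add: field_trace_def x)
  finally have "x + field_trace q n x ^ q = x + field_trace q n x" by (simp add: add.commute)
  then show ?thesis by simp
qed

text \<open>The trace is a polynomial of degree at most \<open>q ^ (m - 1)\<close>, so it cannot
  vanish on \<open>q ^ m\<close> points. It is not the zero polynomial, its coefficient of X being
  1.\<close>

lemma exists_field_trace_nonzero:
  fixes K :: "'a::field set"
  assumes q: "q > 1" and m: "m \<ge> 1" and K: "q ^ m \<le> card K"
  shows "\<exists>y\<in>K. field_trace q m y \<noteq> 0"
proof (rule ccontr)
  assume *: "\<not> ?thesis"
  let ?P = "(\<Sum>i<m. monom 1 (q ^ i)) :: 'a poly"
  have "coeff ?P 1 = (\<Sum>i<m. if i = 0 then 1 else 0)"
    unfolding coeff_sum using q by (intro sum.cong) auto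
  also have "\<dots> = 1" using m by simp
  finally have P: "?P \<noteq> 0" by (metis coeff_0 zero_neq_one)
  have "card K \<le> card {x. poly ?P x = 0}"
    using * by (intro card_mono poly_roots_finite P)
      (auto simp: poly_sum poly_monom field_trace_def)
  also have "\<dots> \<le> degree ?P" by (rule card_poly_roots_bound[OF P])
  also have "\<dots> \<le> q ^ (m - 1)"
    using q by (intro degree_sum_le) (auto intro!: order.trans[OF degree_monom_le] power_increasing)
  also have "\<dots> < q ^ m" using q m by (intro power_strict_increasing) auto
  finally show False using K by simp
qed

section \<open>The canonical additive character on K and its orthogonality\<close>

locale trace_setting =
  fixes p m q n :: nat and K :: "'a::{field,finite} set"
  assumes p: "prime p" and m: "m \<ge> 1" and q: "q = p ^ m"
    and card_UNIV: "CARD('a) = q ^ n"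
    and K: "is_subfield K" and card_K: "card K = q"
begin

lemma CHAR_eq: "CHAR('a) = p"
  by (rule CHAR_eq_of_card_prime_power[OF p, of "m * n"]) (simp add: card_UNIV q power_mult)

lemma prime_CHAR: "prime CHAR('a)"
  using p CHAR_eq by simp

lemma q_eq: "q = CHAR('a) ^ m"
  by (simp add: CHAR_eq q)

lemma K_closed [intro]:
  "0 \<in> K" "1 \<in> K" "x \<in> K \<Longrightarrow> y \<in> K \<Longrightarrow> x + y \<in> K" "x \<in> K \<Longrightarrow> y \<in> K \<Longrightarrow> x * y \<in> K"
  "x \<in> K \<Longrightarrow> - x \<in> K" "x \<in> K \<Longrightarrow> inverse x \<in> K"
  using K by (auto simp: is_subfield_def)

lemma K_diff [intro]: "x \<in> K \<Longrightarrow> y \<in> K \<Longrightarrow> x - y \<in> K"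
  unfolding diff_conv_add_uminus by blast

lemma K_iff: "x \<in> K \<longleftrightarrow> x ^ q = x"
  using subfield_eq_fixed_points[OF K] card_K by auto

lemma field_trace_in_K: "field_trace q n (x :: 'a) \<in> K"
  unfolding K_iff
proof (rule field_trace_power_base[OF prime_CHAR q_eq])
  have "x ^ CARD('a) = x" by (rule subfield_power_card) (auto simp: is_subfield_def)
  then show "x ^ (q ^ n) = x" by (simp add: card_UNIV)
qed

lemma field_trace_linear:
  assumes "e1 \<in> K" "e2 \<in> K" "e3 \<in> K"
  shows "field_trace q n (e1 * x + e2 * y + e3 * z) =
    e1 * field_trace q n x + e2 * field_trace q n y + e3 * field_trace q n z"
  using assms by (simp add: field_trace_add[OF prime_CHAR q_eq] field_trace_scale K_iff)

definition psi_exponent :: "'a \<Rightarrow> nat" where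
  "psi_exponent y = (THE k. k < p \<and> of_nat k = field_trace p m y)"

text \<open>On \<open>K\<close> the absolute trace is fixed by the \<open>p\<close>-th power map, so
  it lies in the prime field, where representatives below \<open>p\<close> exist and are unique.
  Hence the description \<open>THE\<close> is meaningful.\<close>

lemma psi_exponent:
  assumes "y \<in> K"
  shows "psi_exponent y < p" and "of_nat (psi_exponent y) = field_trace p m y"
proof -
  have "field_trace p m y ^ p = field_trace p m y"
    by (rule field_trace_power_base[OF prime_CHAR, of _ 1]) (use assms K_iff q CHAR_eq in auto)
  then have "field_trace p m y \<in> of_nat ` {..<p}"
    using prime_field_eq_fixed_points[OF prime_CHAR] by (simp add: CHAR_eq)
  then obtain k where k: "k < p" "of_nat k = field_trace p m y" by auto
  have "\<exists>!k. k < p \<and> of_nat k = field_trace p m y"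
  proof (rule ex1I[of _ k])
    fix l assume "l < p \<and> of_nat l = field_trace p m y"
    then have "of_nat l = (of_nat k :: 'a)" "l < p" using k by auto
    then show "l = k"
      using k(1) by (auto simp: of_nat_eq_iff_cong_CHAR CHAR_eq cong_def)
  qed (use k in simp)
  then have "psi_exponent y < p \<and> of_nat (psi_exponent y) = field_trace p m y"
    unfolding psi_exponent_def by (rule theI')
  then show "psi_exponent y < p" "of_nat (psi_exponent y) = field_trace p m y" by auto
qed

abbreviation psi :: "'a \<Rightarrow> complex" where
  "psi \<equiv> canonical_add_char p m"

lemma psi_eq: "psi y = cis (2 * pi / real p) ^ psi_exponent y"
  by (simp add: canonical_add_char_def psi_exponent_def cis_conv_exp mult_ac flip: exp_of_nat_mult)

lemma norm_psi: "cmod (psi y) = 1"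
  by (simp add: psi_eq norm_power)

text \<open>The exponents add only modulo \<open>p\<close>, which is enough for powers of a
  \<open>p\<close>-th root of unity.\<close>

lemma psi_add:
  assumes "x \<in> K" "y \<in> K"
  shows "psi (x + y) = psi x * psi y"
proof -
  have "p > 0" using p by (simp add: prime_gt_0_nat)
  have "of_nat (psi_exponent (x + y)) = (of_nat (psi_exponent x + psi_exponent y) :: 'a)"
    using assms field_trace_add[OF prime_CHAR, of p 1 m x y]
    by (simp add: psi_exponent K_closed CHAR_eq)
  then have "[psi_exponent (x + y) = psi_exponent x + psi_exponent y] (mod p)"
    by (simp only: of_nat_eq_iff_cong_CHAR CHAR_eq)
  then show ?thesis
    unfolding psi_eq power_add[symmetric]
    using \<open>p > 0\<close> by (intro power_eq_power_cong) (auto simp: cis_root_unity_power_eq_1_iff)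
qed

lemma psi_0: "psi 0 = 1"
proof -
  have "psi 0 * psi 0 = psi 0" using psi_add[of 0 0] K_closed by simp
  moreover have "psi 0 \<noteq> 0" using norm_psi[of 0] by auto
  ultimately show ?thesis by simp
qed

lemma psi_minus:
  assumes "y \<in> K"
  shows "psi (- y) = cnj (psi y)"
proof -
  have "psi y * psi (- y) = 1" using psi_add[of y "- y"] assms K_closed psi_0 by simp
  moreover have "psi y * cnj (psi y) = 1"
    by (simp add: complex_norm_square[symmetric] norm_psi)
  moreover have "psi y \<noteq> 0" using norm_psi[of y] by auto
  ultimately show ?thesis by (metis mult_cancel_left)
qed

lemma psi_nontrivial: "\<exists>y\<in>K. psi y \<noteq> 1"
proof -
  obtain y where y: "y \<in> K" "field_trace p m y \<noteq> 0"
    using exists_field_trace_nonzero[OF prime_gt_1_nat[OF p] m, of K] card_K q by auto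
  have "psi_exponent y \<noteq> 0" using psi_exponent(2)[OF y(1)] y(2) of_nat_0 by metis
  then have "\<not> p dvd psi_exponent y"
    using psi_exponent(1)[OF y(1)] by (auto dest: dvd_imp_le)
  then have "psi y \<noteq> 1"
    using p by (simp add: psi_eq cis_root_unity_power_eq_1_iff prime_gt_0_nat)
  then show ?thesis using y(1) by blast
qed

text \<open>For nonzero \<open>t\<close>, scaling by \<open>t\<close> permutes \<open>K\<close> and
  reduces to the plain sum of \<open>psi\<close>. Translation by some y with \<open>psi y\<close>
  different from 1 then multiplies that sum by \<open>psi y\<close>, so it is 0.\<close>

lemma psi_orthogonality:
  assumes t: "t \<in> K"
  shows "(\<Sum>e\<in>K. psi (e * t)) = (if t = 0 then of_nat q else 0)"
proof (cases "t = 0")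
  case True
  then show ?thesis by (simp add: psi_0 card_K)
next
  case False
  obtain y where y: "y \<in> K" "psi y \<noteq> 1" using psi_nontrivial by blast
  have "bij_betw (\<lambda>e. e * t) K K"
    by (rule bij_betw_byWitness[where f' = "\<lambda>e. e * inverse t"])
       (use t False in \<open>auto simp: mult.assoc\<close>)
  then have S: "(\<Sum>e\<in>K. psi (e * t)) = (\<Sum>e\<in>K. psi e)"
    by (rule sum.reindex_bij_betw)
  have "bij_betw (\<lambda>e. y + e) K K"
    by (rule bij_betw_byWitness[where f' = "\<lambda>e. e - y"]) (use y in auto)
  then have "(\<Sum>e\<in>K. psi e) = (\<Sum>e\<in>K. psi (y + e))"
    by (rule sum.reindex_bij_betw[symmetric])
  also have "\<dots> = psi y * (\<Sum>e\<in>K. psi e)"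
    using y(1) by (simp add: psi_add sum_distrib_left)
  finally show ?thesis using S y(2) False by simp
qed

lemma sum_psi_triple:
  assumes "s \<in> K" "t \<in> K" "u \<in> K"
  shows "(\<Sum>e1\<in>K. \<Sum>e2\<in>K. \<Sum>e3\<in>K. psi (e1 * s + e2 * t + e3 * u)) =
    (if s = 0 \<and> t = 0 \<and> u = 0 then of_nat q ^ 3 else 0)"
proof -
  have "(\<Sum>e1\<in>K. \<Sum>e2\<in>K. \<Sum>e3\<in>K. psi (e1 * s + e2 * t + e3 * u)) =
      (\<Sum>e1\<in>K. \<Sum>e2\<in>K. \<Sum>e3\<in>K. psi (e1 * s) * (psi (e2 * t) * psi (e3 * u)))"
    using assms by (intro sum.cong refl) (simp add: psi_add K_closed)
  also have "\<dots> = (\<Sum>e\<in>K. psi (e * s)) * ((\<Sum>e\<in>K. psi (e * t)) * (\<Sum>e\<in>K. psi (e * u)))"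
    by (simp only: flip: sum_distrib_left sum_distrib_right)
  also have "\<dots> = (if s = 0 \<and> t = 0 \<and> u = 0 then of_nat q ^ 3 else 0)"
    using assms by (simp add: psi_orthogonality power3_eq_cube)
  finally show ?thesis .
qed

section \<open>The character sums and the counting identity\<close>

text \<open>Linearity of the trace over \<open>K\<close> turns the argument of \<open>psi\<close>
  into a combination of the three defects Tr(\<xi>) - a, Tr(\<xi>^2) - b, Tr(\<xi>^3) - c, and
  summing over the coefficients detects their simultaneous vanishing.\<close>

lemma sum_char_sum:
  assumes abc: "a \<in> K" "b \<in> K" "c \<in> K"
  shows "(\<Sum>e1\<in>K. \<Sum>e2\<in>K. \<Sum>e3\<in>K. char_sum p m n a b c chi e1 e2 e3) =
    (\<Sum>\<xi>\<in>UNIV - {0}. (if field_trace q n \<xi> = a \<and> field_trace q n (\<xi> ^ 2) = b \<and>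
        field_trace q n (\<xi> ^ 3) = c then of_nat q ^ 3 else 0) * chi \<xi>)"
proof -
  let ?u = "\<lambda>\<xi>. field_trace q n \<xi> - a" and ?v = "\<lambda>\<xi>. field_trace q n (\<xi> ^ 2) - b"
    and ?w = "\<lambda>\<xi>. field_trace q n (\<xi> ^ 3) - c"
  have "(\<Sum>e1\<in>K. \<Sum>e2\<in>K. \<Sum>e3\<in>K. char_sum p m n a b c chi e1 e2 e3) =
      (\<Sum>e1\<in>K. \<Sum>e2\<in>K. \<Sum>e3\<in>K. \<Sum>\<xi>\<in>UNIV - {0}.
        psi (e1 * ?u \<xi> + e2 * ?v \<xi> + e3 * ?w \<xi>) * chi \<xi>)"
  proof (intro sum.cong refl)
    fix e1 e2 e3 assume e: "e1 \<in> K" "e2 \<in> K" "e3 \<in> K"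
    have "field_trace (p ^ m) n (e1 * \<xi> + e2 * \<xi> ^ 2 + e3 * \<xi> ^ 3) - e1 * a - e2 * b - e3 * c
        = e1 * ?u \<xi> + e2 * ?v \<xi> + e3 * ?w \<xi>" for \<xi>
      unfolding q[symmetric] field_trace_linear[OF e] by (simp add: algebra_simps)
    then show "char_sum p m n a b c chi e1 e2 e3 =
        (\<Sum>\<xi>\<in>UNIV - {0}. psi (e1 * ?u \<xi> + e2 * ?v \<xi> + e3 * ?w \<xi>) * chi \<xi>)"
      by (simp add: char_sum_def)
  qed
  also have "\<dots> = (\<Sum>\<xi>\<in>UNIV - {0}. \<Sum>e1\<in>K. \<Sum>e2\<in>K. \<Sum>e3\<in>K.
        psi (e1 * ?u \<xi> + e2 * ?v \<xi> + e3 * ?w \<xi>) * chi \<xi>)"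
    \<comment> \<open>Fixing both index sets lets each exchange only move the sum over \<xi>
      outward.\<close>
    by (simp only: sum.swap[of _ "UNIV - {0}" K])
  also have "\<dots> = (\<Sum>\<xi>\<in>UNIV - {0}. (\<Sum>e1\<in>K. \<Sum>e2\<in>K. \<Sum>e3\<in>K.
        psi (e1 * ?u \<xi> + e2 * ?v \<xi> + e3 * ?w \<xi>)) * chi \<xi>)"
    by (simp only: sum_distrib_right)
  also have "\<dots> = (\<Sum>\<xi>\<in>UNIV - {0}. (if field_trace q n \<xi> = a \<and> field_trace q n (\<xi> ^ 2) = b \<and>
        field_trace q n (\<xi> ^ 3) = c then of_nat q ^ 3 else 0) * chi \<xi>)"
    by (subst sum_psi_triple) (use abc field_trace_in_K in auto)
  finally show ?thesis .
qed

lemma char_sum_trivial_zero: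
  fixes a b c :: 'a
  shows "char_sum p m n a b c trivial_char 0 0 0 = of_nat (q ^ n - 1)"
proof -
  have "field_trace (p ^ m) n (0 :: 'a) = 0"
    using p by (auto simp: field_trace_def power_0_left prime_gt_0_nat)
  then have "char_sum p m n a b c trivial_char 0 0 0 = (\<Sum>\<xi>\<in>UNIV - {0 :: 'a}. 1)"
    by (simp add: char_sum_def psi_0 trivial_char_def)
  also have "\<dots> = of_nat (q ^ n - 1)"
    by (simp add: card_Diff_singleton card_UNIV)
  finally show ?thesis .
qed

text \<open>Negating all coefficients negates the argument of \<open>psi\<close>, and the trivial
  character is real. This is what makes T1 real.\<close>

lemma cnj_char_sum_trivial:
  assumes "a \<in> K" "b \<in> K" "c \<in> K" "e1 \<in> K" "e2 \<in> K" "e3 \<in> K"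
  shows "cnj (char_sum p m n a b c trivial_char e1 e2 e3) =
    char_sum p m n a b c trivial_char (- e1) (- e2) (- e3)"
  unfolding char_sum_def cnj_sum
proof (intro sum.cong refl)
  fix \<xi> :: 'a
  let ?t = "\<lambda>e1 e2 e3. field_trace (p ^ m) n (e1 * \<xi> + e2 * \<xi> ^ 2 + e3 * \<xi> ^ 3)
    - e1 * a - e2 * b - e3 * c"
  have "?t (- e1) (- e2) (- e3) = - ?t e1 e2 e3"
    unfolding q[symmetric]
    by (subst (1 2) field_trace_linear) (use assms K_closed in \<open>auto simp: algebra_simps\<close>)
  moreover have "?t e1 e2 e3 \<in> K"
    unfolding q[symmetric] using assms field_trace_in_K by (intro K_diff K_closed)
  ultimately have "psi (?t (- e1) (- e2) (- e3)) = cnj (psi (?t e1 e2 e3))"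
    using psi_minus by metis
  then show "cnj (psi (?t e1 e2 e3) * trivial_char \<xi>) =
      psi (?t (- e1) (- e2) (- e3)) * trivial_char \<xi>"
    by (simp only: complex_cnj_mult) (simp add: trivial_char_def)
qed

text \<open>With the sum over field elements moved outside, the inner weighted sum over characters
  is the indicator of primitivity, and the trace conditions contribute \<open>q ^ 3\<close> or
  0.\<close>

lemma weighted_char_sums_eq:
  assumes abc: "a \<in> K" "b \<in> K" "c \<in> K"
  shows "of_real (theta (q ^ n - 1)) * (\<Sum>d | d dvd q ^ n - 1.
      of_int (moebius_mu d) / of_nat (totient d) *
      (\<Sum>chi | mult_char chi \<and> char_order chi = d.
        \<Sum>e1\<in>K. \<Sum>e2\<in>K. \<Sum>e3\<in>K. char_sum p m n a b c chi e1 e2 e3)) =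
    of_nat (q ^ 3 * card {x. primitive_element x \<and> field_trace q n x = a \<and>
      field_trace q n (x ^ 2) = b \<and> field_trace q n (x ^ 3) = c})"
proof -
  let ?C = "\<lambda>x. field_trace q n x = a \<and> field_trace q n (x ^ 2) = b \<and> field_trace q n (x ^ 3) = c"
  let ?D = "\<lambda>x. if ?C x then of_nat q ^ 3 else (0 :: complex)"
  let ?w = "\<lambda>d. of_int (moebius_mu d) / of_nat (totient d) :: complex"
  let ?th = "of_real (theta (q ^ n - 1)) :: complex"
  have "?th * (\<Sum>d | d dvd q ^ n - 1. ?w d * (\<Sum>chi | mult_char chi \<and> char_order chi = d.
        \<Sum>e1\<in>K. \<Sum>e2\<in>K. \<Sum>e3\<in>K. char_sum p m n a b c chi e1 e2 e3)) =
      ?th * (\<Sum>d | d dvd q ^ n - 1. ?w d * (\<Sum>chi | mult_char chi \<and> char_order chi = d.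
        \<Sum>x\<in>UNIV - {0}. ?D x * chi x))"
    by (simp only: sum_char_sum[OF abc])
  also have "\<dots> = ?th * (\<Sum>d | d dvd q ^ n - 1. \<Sum>x\<in>UNIV - {0}.
        ?D x * (?w d * (\<Sum>chi | mult_char chi \<and> char_order chi = d. chi x)))"
    by (subst sum.swap[of _ "UNIV - {0}"])
       (simp only: sum_distrib_left mult.left_commute)
  also have "\<dots> = (\<Sum>x\<in>UNIV - {0}. ?D x * (?th * (\<Sum>d | d dvd q ^ n - 1.
        ?w d * (\<Sum>chi | mult_char chi \<and> char_order chi = d. chi x))))"
    by (subst sum.swap) (simp only: sum_distrib_left mult.left_commute)
  also have "\<dots> = (\<Sum>x\<in>UNIV - {0}. ?D x * (if primitive_element x then 1 else 0))"
  proof (intro sum.cong refl arg_cong2[of _ _ _ _ "(*)"])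
    fix x :: 'a assume "x \<in> UNIV - {0}"
    then show "?th * (\<Sum>d | d dvd q ^ n - 1.
        ?w d * (\<Sum>chi | mult_char chi \<and> char_order chi = d. chi x)) =
        (if primitive_element x then 1 else 0)"
      using primitive_element_indicator[of x] by (simp only: card_UNIV) auto
  qed
  also have "\<dots> = (\<Sum>x\<in>UNIV - {0}. if primitive_element x \<and> ?C x then of_nat q ^ 3 else 0)"
    by (intro sum.cong) auto
  also have "\<dots> = (\<Sum>x | primitive_element x \<and> ?C x. of_nat q ^ 3)"
    \<comment> \<open>Leaving out 0 loses nothing, since primitive elements are nonzero.\<close>
    by (rule sum.mono_neutral_cong_right) (auto dest: primitive_element_nonzero)
  finally show ?thesis by (simp add: mult.commute)
qed

end

section \<open>From the identity to the inequality\<close>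

theorem theorem3p5:
  fixes p m q n :: nat
    and K :: "'a::{field,finite} set"
    and a b c :: 'a
  assumes "prime p" and "m \<ge> 1" and "q = p ^ m" and "n \<ge> 1"
    and "CARD('a) = q ^ n"
    and "is_subfield K" and "card K = q"
    and "a \<in> K" and "b \<in> K" and "c \<in> K"
  shows
    "let Tr = field_trace q n :: 'a \<Rightarrow> 'a;
         N = card {x::'a. primitive_element x \<and> Tr x = a \<and> Tr (x ^ 2) = b \<and> Tr (x ^ 3) = c};
         S = char_sum p m n a b c;
         chi0 = trivial_char;
         K' = K - {0};
         T1 = (\<Sum>e1\<in>K'. S chi0 e1 0 0);
         T2 = (\<Sum>e2\<in>K'. S chi0 0 e2 0);
         T3 = (\<Sum>e3\<in>K'. S chi0 0 0 e3);
         T4 = (\<Sum>e1\<in>K'. \<Sum>e2\<in>K'. S chi0 e1 e2 0);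
         T5 = (\<Sum>e1\<in>K'. \<Sum>e3\<in>K'. S chi0 e1 0 e3);
         T6 = (\<Sum>e2\<in>K'. \<Sum>e3\<in>K'. S chi0 0 e2 e3);
         T7 = (\<Sum>e1\<in>K'. \<Sum>e2\<in>K'. \<Sum>e3\<in>K'. S chi0 e1 e2 e3);
         T8 = (\<Sum>d | 1 < d \<and> d dvd q ^ n - 1.
                 of_int (moebius_mu d) / of_nat (totient d) *
                 (\<Sum>chi | mult_char chi \<and> char_order chi = d.
                    \<Sum>e1\<in>K. \<Sum>e2\<in>K. \<Sum>e3\<in>K. S chi e1 e2 e3))
     in T1 \<in> \<real> \<and>
        real q ^ 3 * real N \<ge>
          theta (q ^ n - 1) *
            (real q ^ n - 1 + Re T1 -
              (cmod T2 + cmod T3 + cmod T4 + cmod T5 + cmod T6 + cmod T7 + cmod T8))"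
proof -
  interpret trace_setting p m q n K by unfold_locales fact+
  note abc = \<open>a \<in> K\<close> \<open>b \<in> K\<close> \<open>c \<in> K\<close>
  define N where "N = card {x::'a. primitive_element x \<and> field_trace q n x = a \<and>
    field_trace q n (x ^ 2) = b \<and> field_trace q n (x ^ 3) = c}"
  define S where "S = char_sum p m n a b c"
  define S0 where "S0 = S trivial_char"
  define K' where "K' = K - {0}"
  define T1 where "T1 = (\<Sum>e1\<in>K'. S0 e1 0 0)"
  define T2 where "T2 = (\<Sum>e2\<in>K'. S0 0 e2 0)"
  define T3 where "T3 = (\<Sum>e3\<in>K'. S0 0 0 e3)"
  define T4 where "T4 = (\<Sum>e1\<in>K'. \<Sum>e2\<in>K'. S0 e1 e2 0)"
  define T5 where "T5 = (\<Sum>e1\<in>K'. \<Sum>e3\<in>K'. S0 e1 0 e3)"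
  define T6 where "T6 = (\<Sum>e2\<in>K'. \<Sum>e3\<in>K'. S0 0 e2 e3)"
  define T7 where "T7 = (\<Sum>e1\<in>K'. \<Sum>e2\<in>K'. \<Sum>e3\<in>K'. S0 e1 e2 e3)"
  define G where "G d = of_int (moebius_mu d) / of_nat (totient d) *
    (\<Sum>chi | mult_char chi \<and> char_order chi = d. \<Sum>e1\<in>K. \<Sum>e2\<in>K. \<Sum>e3\<in>K. S chi e1 e2 e3)" for d
  define T8 where "T8 = (\<Sum>d | 1 < d \<and> d dvd q ^ n - 1. G d)"
  let ?th = "theta (q ^ n - 1)"

  have M: "q ^ n - 1 > 0" using card_field_minus_one_pos[where 'a = 'a] card_UNIV by simp
  \<comment> \<open>Applied to each of the three coefficients, this splits the triple sum into eight
    blocks according to which coefficients vanish: the main term and T1 to T7.\<close>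
  have K_sum: "(\<Sum>e\<in>K. f e) = f 0 + (\<Sum>e\<in>K'. f e)" for f :: "'a \<Rightarrow> complex"
    unfolding K'_def by (rule sum.remove) (auto intro: K_closed)
  have "G 1 = (\<Sum>e1\<in>K. \<Sum>e2\<in>K. \<Sum>e3\<in>K. S0 e1 e2 e3)"
    unfolding G_def mult_chars_of_order_one S0_def by (simp add: moebius_mu_def)
  also have "\<dots> = S0 0 0 0 + T1 + T2 + T3 + T4 + T5 + T6 + T7"
    by (simp add: K_sum sum.distrib T1_def T2_def T3_def T4_def T5_def T6_def T7_def)
  also have "S0 0 0 0 = of_nat (q ^ n - 1)"
    unfolding S0_def S_def by (rule char_sum_trivial_zero)
  finally have G1: "G 1 = of_nat (q ^ n - 1) + T1 + T2 + T3 + T4 + T5 + T6 + T7" .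
  have "d dvd q ^ n - 1 \<longleftrightarrow> d = 1 \<or> 1 < d \<and> d dvd q ^ n - 1" for d
    using dvd_pos_nat[OF M, of d] by (cases "d = 1") auto
  then have "{d. d dvd q ^ n - 1} = insert 1 {d. 1 < d \<and> d dvd q ^ n - 1}"
    unfolding set_eq_iff insert_iff mem_Collect_eq by (rule allI)
  moreover have "finite {d. 1 < d \<and> d dvd q ^ n - 1}"
    using finite_divisors_nat[OF M] by (rule rev_finite_subset) auto
  ultimately have "(\<Sum>d | d dvd q ^ n - 1. G d) = G 1 + T8"
    by (simp add: T8_def)
  moreover have "of_real ?th * (\<Sum>d | d dvd q ^ n - 1. G d) = of_nat (q ^ 3 * N)"
    unfolding G_def S_def N_def by (rule weighted_char_sums_eq[OF abc])
  ultimately have "of_real ?th *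
      (of_nat (q ^ n - 1) + T1 + T2 + T3 + T4 + T5 + T6 + T7 + T8) = of_nat (q ^ 3 * N)"
    using G1 by simp
  \<comment> \<open>The identity is complex; real parts are taken so that its terms can be compared
    by order.\<close>
  then have "Re (of_real ?th * (of_nat (q ^ n - 1) + T1 + T2 + T3 + T4 + T5 + T6 + T7 + T8)) =
      Re (of_nat (q ^ 3 * N))" by (rule arg_cong)
  then have eq: "real q ^ 3 * real N = ?th * (real (q ^ n - 1) + Re T1 + Re T2 + Re T3 + Re T4 +
      Re T5 + Re T6 + Re T7 + Re T8)"
    by (simp del: of_nat_diff)
  have "cnj T1 = (\<Sum>e\<in>K'. S0 (- e) 0 0)"
    unfolding T1_def cnj_sum S0_def S_def
    by (intro sum.cong refl, subst cnj_char_sum_trivial[OF abc]) (auto simp: K'_def K_closed)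
  \<comment> \<open>The range of the sum is closed under negation.\<close>
  also have "\<dots> = T1"
    unfolding T1_def
    by (rule sum.reindex_bij_witness[where i = uminus and j = uminus]) (auto simp: K'_def K_closed)
  finally have "T1 \<in> \<real>" by (simp only: Reals_cnj_iff)
  \<comment> \<open>T2 to T8 are bounded below by minus their moduli, while T1 is kept
    exactly.\<close>
  have bound: "- cmod z \<le> Re z" for z
    using abs_Re_le_cmod[of z] by linarith
  have "real (q ^ n - 1) = real q ^ n - 1" using M by (simp add: of_nat_diff)
  then have "real q ^ n - 1 + Re T1 -
      (cmod T2 + cmod T3 + cmod T4 + cmod T5 + cmod T6 + cmod T7 + cmod T8) \<le>
      real (q ^ n - 1) + Re T1 + Re T2 + Re T3 + Re T4 + Re T5 + Re T6 + Re T7 + Re T8"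
    using bound[of T2] bound[of T3] bound[of T4] bound[of T5] bound[of T6] bound[of T7] bound[of T8]
    by linarith
  then have "?th * (real q ^ n - 1 + Re T1 -
      (cmod T2 + cmod T3 + cmod T4 + cmod T5 + cmod T6 + cmod T7 + cmod T8)) \<le>
      real q ^ 3 * real N"
    unfolding eq by (rule mult_left_mono) (simp add: theta_def)
  with \<open>T1 \<in> \<real>\<close> show ?thesis
    unfolding Let_def T1_def T2_def T3_def T4_def T5_def T6_def T7_def T8_def G_def N_def K'_def
      S0_def S_def
    by simp
qed

end
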